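(* For a graph $G$, the following are equivalent: (1) $G$ is a Cayley graph (i.e. isomorphic to $\mathcal{C}\langle\mathsf{G},\mathsf{H}\rangle$ for some group $\mathsf{G}$, some non-empty generating subset $\mathsf{H}$ and some injective labelling $\langle\ \rangle:\mathsf{H}\to A$); (2) $G$ is deterministic, strongly connected, simple and vertex-transitive; (3) $G$ is deterministic, strongly connected, simple and circular; (4) $G$ is deterministic, strongly connected, simple and elementary circular.
   Context: Fix an arbitrary set $A$ of labels. A graph is a non-empty set $G\subseteq V\times A\times V$ of labelled edges $s\xrightarrow{a}t$; $V_G$ is the set of vertices occurring in edges. Isomorphism: bijection $f:V_G\to V_H$ with $s\xrightarrow{a}_G t\iff f(s)\xrightarrow{a}_H f(t)$; automorphism: isomorphism $G\to G$. $G$ is simple if $s\xrightarrow{a}t,\ s\xrightarrow{b}t\Rightarrow a=b$; deterministic if $r\xrightarrow{a}s,\ r\xrightarrow{a}t\Rightarrow s=t$; strongly connected if for all $s,t\in V_G$ there is a directed path from $s$ to $t$; vertex-transitive if for all $s,t\in V_G$ some automorphism maps $s$ to $t$. For a word $u=a_1\cdots a_n\in A^*$, $s\xrightarrow{u}t$ means there is a path $s=s_0\xrightarrow{a_1}s_1\cdots\xrightarrow{a_n}s_n=t$; $\mathrm{L}_G(s,t)=\{u\mid s\xrightarrow{u}t\}$. $G$ is circular if $\mathrm{L}_G(s,s)=\mathrm{L}_G(t,t)$ for all $s,t\in V_G$. The elementary cycle language at $s$ is $\mathrm{E}_G(s)=\{a_1\cdots a_n\mid n>0,\ \exists$ pairwise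 distinct $s_0,\dots,s_{n-1}$ with $s=s_0\xrightarrow{a_1}s_1\cdots s_{n-1}\xrightarrow{a_n}s_0\}$; $G$ is elementary circular if $\mathrm{E}_G(s)=\mathrm{E}_G(t)$ for all $s,t\in V_G$. For a group $(\mathsf{G},\cdot)$, non-empty $\mathsf{H}\subseteq\mathsf{G}$ and injective $\langle\ \rangle:\mathsf{H}\to A$, $\mathcal{C}\langle\mathsf{G},\mathsf{H}\rangle=\{(g,\langle h\rangle,g\cdot h)\mid g\in\mathsf{G},h\in\mathsf{H}\}$; $\mathsf{H}$ is generating if every element of $\mathsf{G}$ is a finite product of elements of $\mathsf{H}$. *)

theory Defs
  imports "HOL-Algebra.Group"
begin

text \<open>
  The set of labels is the type \<open>'a\<close>; a graph is a non-empty set of labelled edges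
  (non-emptiness is assumed where it is needed).  There are no isolated vertices.
\<close>

type_synonym ('v, 'a) lgraph = "('v \<times> 'a \<times> 'v) set"

definition verts :: "('v, 'a) lgraph \<Rightarrow> 'v set" where
  "verts G = {s. \<exists>a t. (s, a, t) \<in> G \<or> (t, a, s) \<in> G}"

definition graph_iso :: "('v \<Rightarrow> 'w) \<Rightarrow> ('v, 'a) lgraph \<Rightarrow> ('w, 'a) lgraph \<Rightarrow> bool" where
  "graph_iso f G H \<longleftrightarrow> bij_betw f (verts G) (verts H) \<and>
     (\<forall>s\<in>verts G. \<forall>t\<in>verts G. \<forall>a. (s, a, t) \<in> G \<longleftrightarrow> (f s, a, f t) \<in> H)"

definition isomorphic :: "('v, 'a) lgraph \<Rightarrow> ('w, 'a) lgraph \<Rightarrow> bool" where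
  "isomorphic G H \<longleftrightarrow> (\<exists>f. graph_iso f G H)"

definition simple_graph :: "('v, 'a) lgraph \<Rightarrow> bool" where
  "simple_graph G \<longleftrightarrow> (\<forall>s t a b. (s, a, t) \<in> G \<and> (s, b, t) \<in> G \<longrightarrow> a = b)"

definition deterministic :: "('v, 'a) lgraph \<Rightarrow> bool" where
  "deterministic G \<longleftrightarrow> (\<forall>r s t a. (r, a, s) \<in> G \<and> (r, a, t) \<in> G \<longrightarrow> s = t)"

definition vertex_transitive :: "('v, 'a) lgraph \<Rightarrow> bool" where
  "vertex_transitive G \<longleftrightarrow> (\<forall>s\<in>verts G. \<forall>t\<in>verts G. \<exists>f. graph_iso f G G \<and> f s = t)"

fun word_path :: "('v, 'a) lgraph \<Rightarrow> 'v \<Rightarrow> 'a list \<Rightarrow> 'v \<Rightarrow> bool" where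
  "word_path G s [] t \<longleftrightarrow> s = t"
| "word_path G s (a # u) t \<longleftrightarrow> (\<exists>r. (s, a, r) \<in> G \<and> word_path G r u t)"

definition path_lang :: "('v, 'a) lgraph \<Rightarrow> 'v \<Rightarrow> 'v \<Rightarrow> 'a list set" where
  "path_lang G s t = {u. word_path G s u t}"

definition strongly_connected :: "('v, 'a) lgraph \<Rightarrow> bool" where
  "strongly_connected G \<longleftrightarrow> (\<forall>s\<in>verts G. \<forall>t\<in>verts G. \<exists>u. word_path G s u t)"

definition circular :: "('v, 'a) lgraph \<Rightarrow> bool" where
  "circular G \<longleftrightarrow> (\<forall>s\<in>verts G. \<forall>t\<in>verts G. path_lang G s s = path_lang G t t)"

text \<open>
  The list \<open>ss\<close> holds the vertices \<open>s\<^sub>0, \<dots>, s\<^bsub>n-1\<^esub>\<close>; the index modulo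
  \<open>n\<close> makes the last edge return to \<open>s\<^sub>0\<close>.
\<close>

definition elem_cycle_lang :: "('v, 'a) lgraph \<Rightarrow> 'v \<Rightarrow> 'a list set" where
  "elem_cycle_lang G s = {u. u \<noteq> [] \<and>
     (\<exists>ss. length ss = length u \<and> distinct ss \<and> ss ! 0 = s \<and>
        (\<forall>i<length u. (ss ! i, u ! i, ss ! (Suc i mod length u)) \<in> G))}"

definition elementary_circular :: "('v, 'a) lgraph \<Rightarrow> bool" where
  "elementary_circular G \<longleftrightarrow>
     (\<forall>s\<in>verts G. \<forall>t\<in>verts G. elem_cycle_lang G s = elem_cycle_lang G t)"

definition cayley_graph :: "'g monoid \<Rightarrow> 'g set \<Rightarrow> ('g \<Rightarrow> 'a) \<Rightarrow> ('g, 'a) lgraph" where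
  "cayley_graph \<G> H lab = {(g, lab h, g \<otimes>\<^bsub>\<G>\<^esub> h) | g h. g \<in> carrier \<G> \<and> h \<in> H}"

text \<open>
  Generation is by finite products of elements of \<open>H\<close> only, without inverses; this
  differs from the library's \<open>generate\<close>, which closes under inverses.
\<close>

definition generating :: "'g monoid \<Rightarrow> 'g set \<Rightarrow> bool" where
  "generating \<G> H \<longleftrightarrow>
     (\<forall>g\<in>carrier \<G>. \<exists>hs. set hs \<subseteq> H \<and> g = foldr (\<otimes>\<^bsub>\<G>\<^esub>) hs \<one>\<^bsub>\<G>\<^esub>)"

text \<open>
  The type argument fixes the type from which the elements of the group are drawn, since
  HOL cannot quantify over types inside a formula.
\<close>

definition is_cayley_graph :: "'g itself \<Rightarrow> ('v, 'a) lgraph \<Rightarrow> bool" where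
  "is_cayley_graph (T :: 'g itself) G \<longleftrightarrow>
     (\<exists>(\<G> :: 'g monoid) H lab. group \<G> \<and> H \<subseteq> carrier \<G> \<and> H \<noteq> {} \<and>
        generating \<G> H \<and> inj_on lab H \<and> isomorphic G (cayley_graph \<G> H lab))"

end

theory Submission
  imports Defs
begin

text \<open>
  In a deterministic strongly connected graph an automorphism is determined by the image of one
  vertex. If the graph is also vertex-transitive, its automorphism group therefore acts simply
  transitively on the vertices and can be identified with the vertex set once a base vertex is
  chosen; the graph is the Cayley graph of this group with respect to the successors of the base
  vertex. Circularity yields the automorphism from \<open>s\<close> to \<open>t\<close>: following the same word from \<open>s\<close>
  and from \<open>t\<close> is a well-defined bijection. Elementary circularity is equivalent to circularity
  since every closed walk is reduced to the empty one by excising elementary cycles.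
\<close>

section \<open>Paths and isomorphisms\<close>

lemma edge_verts: "(s, a, t) \<in> G \<Longrightarrow> s \<in> verts G \<and> t \<in> verts G"
  by (auto simp: verts_def)

lemma word_path_append:
  "word_path G s (u @ v) t \<longleftrightarrow> (\<exists>r. word_path G s u r \<and> word_path G r v t)"
  by (induction u arbitrary: s) auto

lemma word_path_verts: "word_path G s u t \<Longrightarrow> s \<in> verts G \<Longrightarrow> t \<in> verts G"
  by (induction u arbitrary: s) (auto dest: edge_verts)

lemma word_path_deterministic:
  "deterministic G \<Longrightarrow> word_path G s u t \<Longrightarrow> word_path G s u t' \<Longrightarrow> t = t'"
proof (induction u arbitrary: s)
  case (Cons a u)
  then show ?case unfolding deterministic_def by (metis word_path.simps(2))
qed simp

lemma word_path_snoc_deterministic: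
  assumes "deterministic G" "word_path G s u q"
  shows "word_path G s (u @ [a]) r \<longleftrightarrow> (q, a, r) \<in> G"
proof
  assume "word_path G s (u @ [a]) r"
  then obtain q' where "word_path G s u q'" "(q', a, r) \<in> G" by (auto simp: word_path_append)
  then show "(q, a, r) \<in> G" using word_path_deterministic[OF assms] by simp
qed (use assms in \<open>auto simp: word_path_append\<close>)

text \<open>With \<open>word_path_traceE\<close> this moves between the recursive view of a walk and
  a function from positions to vertices; only the latter allows speaking of repeated vertices and of
  infixes.\<close>

lemma word_path_trace:
  assumes "\<And>k. k < length u \<Longrightarrow> (p k, u ! k, p (Suc k)) \<in> G"
  shows "word_path G (p 0) u (p (length u))"
  using assms
proof (induction u arbitrary: p)
  case (Cons a u)
  have "word_path G (p (Suc 0)) u (p (Suc (length u)))"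
    using Cons.IH[of "\<lambda>k. p (Suc k)"] Cons.prems by fastforce
  moreover have "(p 0, a, p (Suc 0)) \<in> G"
    using Cons.prems[of 0] by simp
  ultimately show ?case by auto
qed simp

lemma word_path_traceE:
  assumes "word_path G s u t"
  obtains p where "p 0 = s" "p (length u) = t"
    "\<And>k. k < length u \<Longrightarrow> (p k, u ! k, p (Suc k)) \<in> G"
  using assms
proof (induction u arbitrary: s thesis)
  case Nil
  then show ?case using Nil.prems(1)[of "\<lambda>_. s"] by simp
next
  case (Cons a u)
  then obtain r where r: "(s, a, r) \<in> G" "word_path G r u t" by auto
  obtain p where p: "p 0 = r" "p (length u) = t"
    "\<And>k. k < length u \<Longrightarrow> (p k, u ! k, p (Suc k)) \<in> G"
    using Cons.IH[OF _ r(2)] by blast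
  \<comment> \<open>\<open>case_nat s p\<close> puts \<open>s\<close> at position 0 and shifts the
    trace of the tail by one.\<close>
  show ?case
    by (rule Cons.prems(1)[of "case_nat s p"]) (use r p in \<open>auto simp: less_Suc_eq_0_disj\<close>)
qed

lemma word_path_subtrace:
  assumes "\<And>k. k < length u \<Longrightarrow> (p k, u ! k, p (Suc k)) \<in> G" and "i \<le> j" "j \<le> length u"
  shows "word_path G (p i) (take (j - i) (drop i u)) (p j)"
  using word_path_trace[of "take (j - i) (drop i u)" "\<lambda>k. p (i + k)" G] assms by simp

section \<open>Isomorphisms and the rigidity of automorphisms\<close>

lemma graph_iso_edge:
  "graph_iso f G H \<Longrightarrow> s \<in> verts G \<Longrightarrow> t \<in> verts G \<Longrightarrow> (f s, a, f t) \<in> H \<longleftrightarrow> (s, a, t) \<in> G"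
  by (simp add: graph_iso_def)

lemma graph_iso_verts: "graph_iso f G H \<Longrightarrow> s \<in> verts G \<Longrightarrow> f s \<in> verts H"
  by (auto simp: graph_iso_def bij_betw_def)

lemma graph_iso_id: "graph_iso (\<lambda>x. x) G G"
  by (simp add: graph_iso_def bij_betw_def)

lemma graph_iso_comp: "graph_iso f G H \<Longrightarrow> graph_iso g H K \<Longrightarrow> graph_iso (\<lambda>x. g (f x)) G K"
  using bij_betw_trans[of f "verts G" "verts H" g "verts K"] graph_iso_verts[of f G H]
  by (simp add: graph_iso_def comp_def)

lemma graph_iso_inverse:
  assumes "graph_iso f G H"
  obtains g where "graph_iso g H G" "\<And>x. x \<in> verts G \<Longrightarrow> g (f x) = x"
    "\<And>y. y \<in> verts H \<Longrightarrow> f (g y) = y"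
proof
  let ?g = "inv_into (verts G) f"
  have f: "bij_betw f (verts G) (verts H)" using assms by (simp add: graph_iso_def)
  then have g: "bij_betw ?g (verts H) (verts G)" by (rule bij_betw_inv_into)
  show "?g (f x) = x" if "x \<in> verts G" for x using that f by (simp add: bij_betw_inv_into_left)
  show r: "f (?g y) = y" if "y \<in> verts H" for y using that f by (simp add: bij_betw_inv_into_right)
  have "(s, a, t) \<in> H \<longleftrightarrow> (?g s, a, ?g t) \<in> G" if "s \<in> verts H" "t \<in> verts H" for s t a
    using graph_iso_edge[OF assms, of "?g s" "?g t" a] that r bij_betwE[OF g] by simp
  with g show "graph_iso ?g H G" by (simp add: graph_iso_def)
qed

lemma graph_iso_word_path:
  assumes "graph_iso f G H"
  shows "word_path G s u t \<Longrightarrow> s \<in> verts G \<Longrightarrow> word_path H (f s) u (f t)"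
proof (induction u arbitrary: s)
  case (Cons a u)
  then obtain r where r: "(s, a, r) \<in> G" "word_path G r u t" by auto
  then have "(f s, a, f r) \<in> H" using graph_iso_edge[OF assms] edge_verts by metis
  then show ?case using Cons.IH r edge_verts by (metis word_path.simps(2))
qed simp

text \<open>A word leading from \<open>s\<close> to \<open>t\<close> leads from the common image of
  \<open>s\<close> both to \<open>f t\<close> and to \<open>g t\<close>; determinism identifies
  these two.\<close>

lemma automorphism_unique:
  assumes "deterministic G" "strongly_connected G" "graph_iso f G G" "graph_iso g G G"
    and "s \<in> verts G" "f s = g s" "t \<in> verts G"
  shows "f t = g t"
proof -
  obtain u where "word_path G s u t" using assms unfolding strongly_connected_def by blast
  then have "word_path G (f s) u (f t)" "word_path G (f s) u (g t)"
    using graph_iso_word_path[OF assms(3)] graph_iso_word_path[OF assms(4)] assms(5,6)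
    by metis+
  then show ?thesis by (rule word_path_deterministic[OF assms(1)])
qed

section \<open>Cayley graphs\<close>

lemma deterministic_iso:
  assumes "graph_iso f G H" "deterministic H" shows "deterministic G"
  unfolding deterministic_def
proof (intro allI impI, elim conjE)
  fix r s t a assume e: "(r, a, s) \<in> G" "(r, a, t) \<in> G"
  then have v: "r \<in> verts G" "s \<in> verts G" "t \<in> verts G" by (auto dest: edge_verts)
  with e have "f s = f t" using assms graph_iso_edge[OF assms(1)] unfolding deterministic_def by metis
  then show "s = t" using assms(1) v by (auto simp: graph_iso_def bij_betw_def dest: inj_onD)
qed

lemma simple_graph_iso:
  assumes "graph_iso f G H" "simple_graph H" shows "simple_graph G"
  unfolding simple_graph_def
proof (intro allI impI, elim conjE)
  fix s t a b assume "(s, a, t) \<in> G" "(s, b, t) \<in> G"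
  then show "a = b"
    using assms graph_iso_edge[OF assms(1)] edge_verts unfolding simple_graph_def by metis
qed

lemma strongly_connected_iso:
  assumes "graph_iso f G H" "strongly_connected H" shows "strongly_connected G"
  unfolding strongly_connected_def
proof (intro ballI)
  fix s t assume v: "s \<in> verts G" "t \<in> verts G"
  obtain g where g: "graph_iso g H G" "\<And>x. x \<in> verts G \<Longrightarrow> g (f x) = x"
    using graph_iso_inverse[OF assms(1)] by metis
  obtain u where "word_path H (f s) u (f t)"
    using assms v graph_iso_verts unfolding strongly_connected_def by metis
  then show "\<exists>u. word_path G s u t"
    using graph_iso_word_path[OF g(1)] g(2) v graph_iso_verts[OF assms(1)] by metis
qed

lemma vertex_transitive_iso:
  assumes "graph_iso f G H" "vertex_transitive H" shows "vertex_transitive G"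
  unfolding vertex_transitive_def
proof (intro ballI)
  fix s t assume v: "s \<in> verts G" "t \<in> verts G"
  obtain g where g: "graph_iso g H G" "\<And>x. x \<in> verts G \<Longrightarrow> g (f x) = x"
    using graph_iso_inverse[OF assms(1)] by metis
  obtain h where h: "graph_iso h H H" "h (f s) = f t"
    using assms v graph_iso_verts unfolding vertex_transitive_def by metis
  have "graph_iso (\<lambda>x. g (h (f x))) G G"
    using graph_iso_comp[OF graph_iso_comp[OF assms(1) h(1)] g(1)] .
  with h(2) g(2) v show "\<exists>k. graph_iso k G G \<and> k s = t" by auto
qed

section \<open>Properties of Cayley graphs\<close>

lemma mem_cayley_graph:
  "(s, a, t) \<in> cayley_graph \<G> H lab \<longleftrightarrow>
    s \<in> carrier \<G> \<and> (\<exists>h\<in>H. a = lab h \<and> t = s \<otimes>\<^bsub>\<G>\<^esub> h)"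
  by (auto simp: cayley_graph_def)

lemma deterministic_cayley_graph: "inj_on lab H \<Longrightarrow> deterministic (cayley_graph \<G> H lab)"
  by (auto simp: deterministic_def mem_cayley_graph dest: inj_onD)

lemma (in group) foldr_mult_closed:
  "set hs \<subseteq> carrier G \<Longrightarrow> foldr (\<otimes>) hs \<one> \<in> carrier G"
  by (induction hs) auto

context
  fixes G :: "'g monoid" (structure)
  assumes group_G: "group G"
begin

interpretation group G by (fact group_G)

lemma verts_cayley_graph:
  assumes "H \<subseteq> carrier G" "H \<noteq> {}"
  shows "verts (cayley_graph G H lab) = carrier G"
proof
  show "verts (cayley_graph G H lab) \<subseteq> carrier G"
    using assms(1) by (auto simp: verts_def mem_cayley_graph)
  show "carrier G \<subseteq> verts (cayley_graph G H lab)"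
    using assms(2) by (auto simp: verts_def mem_cayley_graph)
qed

text \<open>Left cancellation: the endpoints \<open>s\<close> and \<open>s \<otimes> h\<close> of an
  edge determine \<open>h\<close>, hence its label.\<close>

lemma simple_cayley_graph: "H \<subseteq> carrier G \<Longrightarrow> simple_graph (cayley_graph G H lab)"
  unfolding simple_graph_def mem_cayley_graph by (metis Units_eq Units_l_cancel subsetD)

text \<open>Each edge multiplies on the right by one generator, so a walk accumulates the product of
  the generators read.\<close>

lemma word_path_cayley_graph:
  assumes "H \<subseteq> carrier G"
  shows "set hs \<subseteq> H \<Longrightarrow> g \<in> carrier G \<Longrightarrow>
    word_path (cayley_graph G H lab) g (map lab hs) (g \<otimes> foldr (\<otimes>) hs \<one>)"
proof (induction hs arbitrary: g)
  case (Cons h hs)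
  then have h: "h \<in> H" "h \<in> carrier G" "foldr (\<otimes>) hs \<one> \<in> carrier G"
    using assms foldr_mult_closed[of hs] by auto
  have "(g, lab h, g \<otimes> h) \<in> cayley_graph G H lab"
    using h Cons.prems by (auto simp: mem_cayley_graph)
  moreover have "word_path (cayley_graph G H lab) (g \<otimes> h) (map lab hs)
      (g \<otimes> h \<otimes> foldr (\<otimes>) hs \<one>)"
    using Cons h by simp
  ultimately show ?case using h Cons.prems by (auto simp: m_assoc)
qed simp

lemma strongly_connected_cayley_graph:
  assumes "H \<subseteq> carrier G" "H \<noteq> {}" "generating G H"
  shows "strongly_connected (cayley_graph G H lab)"
  unfolding strongly_connected_def verts_cayley_graph[OF assms(1,2)]
proof (intro ballI)
  fix s t assume v: "s \<in> carrier G" "t \<in> carrier G"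
  \<comment> \<open>A factorization of \<open>inv s \<otimes> t\<close> into generators spells a
    word from \<open>s\<close> to \<open>t\<close>.\<close>
  then have "inv s \<otimes> t \<in> carrier G" by simp
  then obtain hs where hs: "set hs \<subseteq> H" "inv s \<otimes> t = foldr (\<otimes>) hs \<one>"
    using assms(3) unfolding generating_def by blast
  have "s \<otimes> (inv s \<otimes> t) = t" using v by (simp add: m_assoc[symmetric])
  then show "\<exists>u. word_path (cayley_graph G H lab) s u t"
    using word_path_cayley_graph[OF assms(1) hs(1) v(1)] hs(2) by metis
qed

lemma vertex_transitive_cayley_graph:
  assumes "H \<subseteq> carrier G" "H \<noteq> {}"
  shows "vertex_transitive (cayley_graph G H lab)"
  unfolding vertex_transitive_def verts_cayley_graph[OF assms]
proof (intro ballI)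
  fix s t assume v: "s \<in> carrier G" "t \<in> carrier G"
  \<comment> \<open>Left translation by \<open>?c\<close> takes \<open>s\<close> to
    \<open>t\<close>. It respects edges because these are right multiplications, and left and right
    multiplications commute by associativity.\<close>
  let ?c = "t \<otimes> inv s"
  have c: "?c \<in> carrier G" using v by simp
  have "bij_betw (\<lambda>x. ?c \<otimes> x) (carrier G) (carrier G)"
    by (rule bij_betw_byWitness[where f' = "\<lambda>x. inv ?c \<otimes> x"])
      (use c in \<open>auto simp: m_assoc[symmetric] simp del: m_assoc\<close>)
  moreover have "(x, a, y) \<in> cayley_graph G H lab
      \<longleftrightarrow> (?c \<otimes> x, a, ?c \<otimes> y) \<in> cayley_graph G H lab"
    if "x \<in> carrier G" "y \<in> carrier G" for x y a
  proof -
    have "?c \<otimes> y = ?c \<otimes> x \<otimes> h \<longleftrightarrow> y = x \<otimes> h" if "h \<in> H" for h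
    proof -
      have "h \<in> carrier G" using that assms by auto
      then show ?thesis
        using \<open>x \<in> carrier G\<close> \<open>y \<in> carrier G\<close> c Units_l_cancel[of ?c y "x \<otimes> h"] m_assoc[of ?c x h] by simp
    qed
    then show ?thesis using that c by (auto simp: mem_cayley_graph)
  qed
  ultimately have "graph_iso (\<lambda>x. ?c \<otimes> x) (cayley_graph G H lab) (cayley_graph G H lab)"
    by (simp add: graph_iso_def verts_cayley_graph[OF assms])
  moreover have "?c \<otimes> s = t" using v by (simp add: m_assoc)
  ultimately show "\<exists>f. graph_iso f (cayley_graph G H lab) (cayley_graph G H lab) \<and> f s = t"
    by blast
qed

end

lemma is_cayley_graph_imp_vertex_transitive:
  assumes "is_cayley_graph TYPE('g) G"
  shows "deterministic G \<and> strongly_connected G \<and> simple_graph G \<and> vertex_transitive G"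
proof -
  obtain \<G> :: "'g monoid" and H lab f where *: "group \<G>" "H \<subseteq> carrier \<G>" "H \<noteq> {}"
      "generating \<G> H" "inj_on lab H" "graph_iso f G (cayley_graph \<G> H lab)"
    using assms unfolding is_cayley_graph_def isomorphic_def by blast
  then show ?thesis
    using deterministic_cayley_graph simple_cayley_graph[OF *(1)]
      strongly_connected_cayley_graph[OF *(1)] vertex_transitive_cayley_graph[OF *(1)]
      deterministic_iso simple_graph_iso strongly_connected_iso vertex_transitive_iso by metis
qed

section \<open>Recovering the group from a vertex-transitive graph\<close>

lemma vertex_transitive_imp_is_cayley_graph:
  fixes G :: "('v, 'a) lgraph"
  assumes "G \<noteq> {}" and det: "deterministic G" and sc: "strongly_connected G"
    and simple: "simple_graph G" and vt: "vertex_transitive G"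
  shows "is_cayley_graph TYPE('v) G"
proof -
  obtain e a0 e' where e0: "(e, a0, e') \<in> G" using assms(1) by auto
  then have e: "e \<in> verts G" by (auto dest: edge_verts)
  have "\<forall>x\<in>verts G. \<exists>f. graph_iso f G G \<and> f e = x"
    using vt e by (auto simp: vertex_transitive_def)
  \<comment> \<open>\<open>F x\<close> is a chosen automorphism moving the base vertex
    \<open>e\<close> to \<open>x\<close>; by rigidity its values on vertices do not depend on the
    choice.\<close>
  then obtain F where F: "\<And>x. x \<in> verts G \<Longrightarrow> graph_iso (F x) G G"
      and Fe: "\<And>x. x \<in> verts G \<Longrightarrow> F x e = x"
    by metis
  have FV: "F x y \<in> verts G" if "x \<in> verts G" "y \<in> verts G" for x y
    using graph_iso_verts[OF F] that .
  have F_unique: "F (f e) y = f y" if "graph_iso f G G" "y \<in> verts G" for f y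
    using automorphism_unique[OF det sc F that(1) e Fe that(2)] graph_iso_verts[OF that(1) e] by simp
  \<comment> \<open>Composition of automorphisms transported to vertices: the composite of
    \<open>F x\<close> and \<open>F y\<close> moves \<open>e\<close> to \<open>F x y\<close>, so
    that vertex is the product of \<open>x\<close> and \<open>y\<close>. Associativity then follows
    from \<open>F_unique\<close> applied to this composite.\<close>
  define M :: "'v monoid" where "M = \<lparr>carrier = verts G, mult = F, one = e\<rparr>"
  have M [simp]: "carrier M = verts G" "mult M = F" "one M = e" by (simp_all add: M_def)
  interpret M: group M
  proof (rule groupI)
    fix x y z assume "x \<in> carrier M" "y \<in> carrier M" "z \<in> carrier M"
    then show "x \<otimes>\<^bsub>M\<^esub> y \<otimes>\<^bsub>M\<^esub> z = x \<otimes>\<^bsub>M\<^esub> (y \<otimes>\<^bsub>M\<^esub> z)"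
      using F_unique[OF graph_iso_comp[OF F F], of y x z] Fe by simp
  next
    fix x assume x: "x \<in> carrier M"
    then show "\<one>\<^bsub>M\<^esub> \<otimes>\<^bsub>M\<^esub> x = x" using F_unique[OF graph_iso_id, of x] by simp
    \<comment> \<open>The inverse \<open>k\<close> of \<open>F x\<close> moves \<open>x\<close> back
      to \<open>e\<close>. Since \<open>F (k e)\<close> agrees with \<open>k\<close> on vertices,
      \<open>k e\<close> is a left inverse of \<open>x\<close>.\<close>
    obtain k where k: "graph_iso k G G" "\<And>y. y \<in> verts G \<Longrightarrow> k (F x y) = y"
      using graph_iso_inverse[OF F] x by (metis M(1))
    have "F (k e) x = e" using F_unique[OF k(1), of x] k(2)[OF e] x Fe by simp
    then show "\<exists>y\<in>carrier M. y \<otimes>\<^bsub>M\<^esub> x = \<one>\<^bsub>M\<^esub>"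
      using graph_iso_verts[OF k(1) e] by auto
  qed (use FV e in auto)
  \<comment> \<open>The generators are the successors of \<open>e\<close>. Simplicity leaves one
    label on the edge from \<open>e\<close> to each of them, so the description in
    \<open>lab\<close> is well defined; determinism makes \<open>lab\<close> injective.\<close>
  define H where "H = {h. \<exists>a. (e, a, h) \<in> G}"
  define lab where "lab h = (THE a. (e, a, h) \<in> G)" for h
  have lab: "lab h = a" if "(e, a, h) \<in> G" for a h
    unfolding lab_def using that simple by (auto simp: simple_graph_def)
  have H_lab: "(e, lab h, h) \<in> G" if "h \<in> H" for h using that lab by (auto simp: H_def)
  have H: "H \<subseteq> carrier M" "H \<noteq> {}" using e0 by (auto simp: H_def dest: edge_verts)
  have "inj_on lab H"
    using det H_lab unfolding inj_on_def deterministic_def by metis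
  \<comment> \<open>\<open>F x\<close> carries the edges leaving \<open>e\<close> to edges leaving
    \<open>x\<close> with the same labels, and its inverse carries them back.\<close>
  have edge: "(x, a, y) \<in> G \<longleftrightarrow> (\<exists>h\<in>H. a = lab h \<and> y = F x h)" if x: "x \<in> verts G" for x a y
  proof
    assume xy: "(x, a, y) \<in> G"
    then have y: "y \<in> verts G" by (auto dest: edge_verts)
    obtain k where k: "graph_iso k G G" "\<And>y. y \<in> verts G \<Longrightarrow> k (F x y) = y"
        "\<And>y. y \<in> verts G \<Longrightarrow> F x (k y) = y"
      using graph_iso_inverse[OF F[OF x]] by metis
    have "k x = e" using k(2)[OF e] Fe x by simp
    then have "(e, a, k y) \<in> G" using graph_iso_edge[OF k(1) x y] xy by simp
    then show "\<exists>h\<in>H. a = lab h \<and> y = F x h" using lab k(3)[OF y] by (auto simp: H_def)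
  next
    assume "\<exists>h\<in>H. a = lab h \<and> y = F x h"
    then obtain h where h: "h \<in> H" "a = lab h" "y = F x h" by auto
    then show "(x, a, y) \<in> G"
      using graph_iso_edge[OF F[OF x] e, of h a] H_lab[of h] H(1) Fe x by auto
  qed
  have "cayley_graph M H lab = G"
  proof (rule Set.set_eqI)
    fix x :: "'v \<times> 'a \<times> 'v"
    obtain s a t where "x = (s, a, t)" by (cases x)
    then show "x \<in> cayley_graph M H lab \<longleftrightarrow> x \<in> G"
      using edge[of s a t] edge_verts[of s a t G] by (auto simp: mem_cayley_graph)
  qed
  then have "isomorphic G (cayley_graph M H lab)"
    using graph_iso_id unfolding isomorphic_def by metis
  \<comment> \<open>Every edge of a walk contributes one generator. The start is general for the
    sake of the induction; at \<open>s = e\<close>, strong connectivity makes every vertex a product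
    of generators.\<close>
  have "\<exists>hs. set hs \<subseteq> H \<and> t = s \<otimes>\<^bsub>M\<^esub> foldr (\<otimes>\<^bsub>M\<^esub>) hs \<one>\<^bsub>M\<^esub>"
    if "word_path G s u t" "s \<in> carrier M" for s u t
    using that
  proof (induction u arbitrary: s)
    case Nil
    then show ?case by (intro exI[of _ "[]"]) (use M.r_one[of s] in simp)
  next
    case (Cons a u)
    then obtain r where r: "(s, a, r) \<in> G" "word_path G r u t" by auto
    then obtain hs where hs: "set hs \<subseteq> H" "t = r \<otimes>\<^bsub>M\<^esub> foldr (\<otimes>\<^bsub>M\<^esub>) hs \<one>\<^bsub>M\<^esub>"
      using Cons.IH by (metis M(1) edge_verts)
    obtain h where h: "h \<in> H" "r = s \<otimes>\<^bsub>M\<^esub> h" using r edge Cons.prems by auto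
    have "foldr (\<otimes>\<^bsub>M\<^esub>) hs \<one>\<^bsub>M\<^esub> \<in> carrier M" "h \<in> carrier M"
      using M.foldr_mult_closed hs h H by auto
    then have "t = s \<otimes>\<^bsub>M\<^esub> foldr (\<otimes>\<^bsub>M\<^esub>) (h # hs) \<one>\<^bsub>M\<^esub>"
      using M.m_assoc[OF Cons.prems(2)] hs(2) h(2) by simp
    then show ?case using hs h by (intro exI[of _ "h # hs"]) auto
  qed
  from this[of e] have "generating M H"
    unfolding generating_def
    using sc e M.l_one M.foldr_mult_closed H(1) unfolding strongly_connected_def
    by (metis M(1) M(3) subset_trans)
  then show ?thesis
    unfolding is_cayley_graph_def
    using M.group_axioms H \<open>inj_on lab H\<close> \<open>isomorphic G (cayley_graph M H lab)\<close> by blast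
qed

section \<open>Circularity\<close>

lemma vertex_transitive_imp_circular:
  assumes "vertex_transitive G" shows "circular G"
proof -
  have "path_lang G s s \<subseteq> path_lang G t t" if "s \<in> verts G" "t \<in> verts G" for s t
    using assms that graph_iso_word_path unfolding vertex_transitive_def path_lang_def by fastforce
  then show ?thesis unfolding circular_def by blast
qed

lemma circularD:
  "circular G \<Longrightarrow> word_path G s u s \<Longrightarrow> s \<in> verts G \<Longrightarrow> t \<in> verts G \<Longrightarrow> word_path G t u t"
  unfolding circular_def path_lang_def by blast

text \<open>Prolong the walk from \<open>s\<close> to a closed one; circularity yields a closed walk
  at \<open>t\<close> with the same word, and \<open>u\<close> labels a prefix of it.\<close>

lemma circular_word_path_ex:
  assumes "strongly_connected G" "circular G" "s \<in> verts G" "t \<in> verts G" "word_path G s u r"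
  shows "\<exists>r'. word_path G t u r'"
proof -
  obtain w where "word_path G r w s"
    using assms word_path_verts unfolding strongly_connected_def by metis
  then have "word_path G s (u @ w) s" using assms by (auto simp: word_path_append)
  then have "word_path G t (u @ w) t" using circularD assms by metis
  then show ?thesis by (auto simp: word_path_append)
qed

text \<open>This makes following words from \<open>t\<close> instead of \<open>s\<close> well
  defined. Close \<open>v\<close> by a word \<open>w\<close> from \<open>r\<close> back to
  \<open>s\<close>. By circularity and determinism \<open>w\<close> also leads from
  \<open>r2\<close> to \<open>t\<close>, so \<open>w @ u\<close> leads from \<open>r2\<close> to
  \<open>r1\<close>. But \<open>w @ u\<close> is closed at \<open>r\<close>, hence at
  \<open>r2\<close>.\<close>

lemma circular_word_path_unique:
  assumes det: "deterministic G" and sc: "strongly_connected G" and circ: "circular G"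
    and v: "s \<in> verts G" "t \<in> verts G"
    and r: "word_path G s u r" "word_path G s v r"
    and r12: "word_path G t u r1" "word_path G t v r2"
  shows "r1 = r2"
proof -
  have rV: "r \<in> verts G" "r2 \<in> verts G" using r r12 v word_path_verts by metis+
  obtain w where w: "word_path G r w s" using sc v rV unfolding strongly_connected_def by metis
  have "word_path G s (v @ w) s" using r w by (auto simp: word_path_append)
  then have "word_path G t (v @ w) t" using circularD[OF circ] v by metis
  then have "word_path G r2 w t"
    using word_path_deterministic[OF det r12(2)] by (auto simp: word_path_append)
  then have "word_path G r2 (w @ u) r1" using r12 by (auto simp: word_path_append)
  moreover have "word_path G r (w @ u) r" using r w by (auto simp: word_path_append)
  then have "word_path G r2 (w @ u) r2" using circularD[OF circ] rV by metis
  ultimately show ?thesis using word_path_deterministic[OF det] by metis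
qed

lemma circular_imp_vertex_transitive:
  assumes det: "deterministic G" and sc: "strongly_connected G" and circ: "circular G"
  shows "vertex_transitive G"
  unfolding vertex_transitive_def
proof (intro ballI)
  fix s t assume v: "s \<in> verts G" "t \<in> verts G"
  note ex = circular_word_path_ex[OF sc circ]
  note unique = circular_word_path_unique[OF det sc circ]
  have path: "\<exists>u. word_path G s u r" "\<exists>u. word_path G t u r" if "r \<in> verts G" for r
    using sc v that by (auto simp: strongly_connected_def)
  \<comment> \<open>The vertex \<open>r'\<close> is reached from \<open>t\<close> by exactly the
    words that reach \<open>r\<close> from \<open>s\<close>. Left to right this makes the map well
    defined; right to left it will make it injective.\<close>
  have "\<exists>r'. \<forall>u. word_path G s u r \<longleftrightarrow> word_path G t u r'" if r: "r \<in> verts G" for r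
  proof -
    obtain v' where v': "word_path G s v' r" using path(1)[OF r] by auto
    obtain r' where r': "word_path G t v' r'" using ex[OF v v'] by auto
    have "word_path G t u r'" if "word_path G s u r" for u
      using ex[OF v that] unique[OF v v' that r'] by auto
    moreover have "word_path G s u r" if "word_path G t u r'" for u
      using ex[OF v(2,1) that] unique[OF v(2,1) r' that v'] by auto
    ultimately show ?thesis by blast
  qed
  then obtain f where f: "\<And>r u. r \<in> verts G \<Longrightarrow> word_path G s u r \<longleftrightarrow> word_path G t u (f r)"
    by metis
  have fV: "f r \<in> verts G" if "r \<in> verts G" for r
    using f path(1) word_path_verts that v by metis
  have "inj_on f (verts G)"
  proof (rule inj_onI)
    fix q r assume "q \<in> verts G" "r \<in> verts G" "f q = f r"
    then show "q = r" using f path(1) word_path_deterministic[OF det] by metis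
  qed
  moreover have "r \<in> f ` verts G" if "r \<in> verts G" for r
  proof -
    obtain u where u: "word_path G t u r" using path(2)[OF \<open>r \<in> verts G\<close>] by auto
    then obtain q where q: "word_path G s u q" using ex[OF v(2,1)] by auto
    then have qV: "q \<in> verts G" using word_path_verts v by metis
    then have "f q = r" using f q u word_path_deterministic[OF det] by metis
    then show ?thesis using qV by auto
  qed
  ultimately have "bij_betw f (verts G) (verts G)" using fV by (auto simp: bij_betw_def)
  moreover have "(q, a, r) \<in> G \<longleftrightarrow> (f q, a, f r) \<in> G" if "q \<in> verts G" "r \<in> verts G" for q r a
  proof -
    obtain u where u: "word_path G s u q" "word_path G t u (f q)"
      using path(1)[OF \<open>q \<in> verts G\<close>] f[OF \<open>q \<in> verts G\<close>] by auto
    \<comment> \<open>Appending \<open>a\<close> to a word reaching \<open>q\<close> turns the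
      question about an edge into one about words, which \<open>f\<close> preserves.\<close>
    have "(q, a, r) \<in> G \<longleftrightarrow> word_path G s (u @ [a]) r"
      using word_path_snoc_deterministic[OF det u(1)] by simp
    also have "\<dots> \<longleftrightarrow> word_path G t (u @ [a]) (f r)" using f that by metis
    also have "\<dots> \<longleftrightarrow> (f q, a, f r) \<in> G"
      using word_path_snoc_deterministic[OF det u(2)] by simp
    finally show ?thesis .
  qed
  ultimately have "graph_iso f G G" by (simp add: graph_iso_def)
  moreover have "f s = t" using f[OF v(1), of "[]"] by simp
  ultimately show "\<exists>f. graph_iso f G G \<and> f s = t" by blast
qed

section \<open>Elementary cycles\<close>

text \<open>Replaces the modular index by an explicit final position \<open>length u\<close>, to fit
  the traces above. That position repeats position 0, so injectivity is asked only strictly below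
  it.\<close>

lemma elem_cycle_lang_iff:
  "u \<in> elem_cycle_lang G s \<longleftrightarrow> u \<noteq> [] \<and> (\<exists>p. p 0 = s \<and> p (length u) = s \<and>
     inj_on p {..<length u} \<and> (\<forall>k<length u. (p k, u ! k, p (Suc k)) \<in> G))"
  (is "_ \<longleftrightarrow> ?R")
proof
  assume "u \<in> elem_cycle_lang G s"
  then obtain ss where u: "u \<noteq> []" and ss: "length ss = length u" "distinct ss" "ss ! 0 = s"
      "\<And>i. i < length u \<Longrightarrow> (ss ! i, u ! i, ss ! (Suc i mod length u)) \<in> G"
    by (auto simp: elem_cycle_lang_def)
  have "inj_on (\<lambda>k. ss ! (k mod length u)) {..<length u}"
    using ss by (auto simp: inj_on_def nth_eq_iff_index_eq)
  with u ss show ?R by (intro conjI exI[of _ "\<lambda>k. ss ! (k mod length u)"]) auto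
next
  assume ?R
  then obtain p where u: "u \<noteq> []" and p: "p 0 = s" "p (length u) = s" "inj_on p {..<length u}"
      "\<And>k. k < length u \<Longrightarrow> (p k, u ! k, p (Suc k)) \<in> G"
    by blast
  have "(p i, u ! i, map p [0..<length u] ! (Suc i mod length u)) \<in> G" if "i < length u" for i
  \<comment> \<open>At the last edge the index wraps to 0, where \<open>p 0\<close> and
    \<open>p (length u)\<close> are both \<open>s\<close>.\<close>
  proof (cases "Suc i = length u")
    case True
    then show ?thesis using p(1,2) p(4)[OF that] u by simp
  next
    case False
    then show ?thesis using p(4)[OF that] that by simp
  qed
  then show "u \<in> elem_cycle_lang G s"
    unfolding elem_cycle_lang_def using u p
    by (auto intro!: exI[of _ "map p [0..<length u]"] simp: distinct_map atLeast0LessThan)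
qed

text \<open>Circularity supplies the closed walk at \<open>t\<close>; what needs an argument is that
  it repeats no vertex before its end.\<close>

lemma circular_imp_elementary_circular:
  assumes det: "deterministic G" and circ: "circular G"
  shows "elementary_circular G"
proof -
  have "u \<in> elem_cycle_lang G t"
    if v: "s \<in> verts G" "t \<in> verts G" and u: "u \<in> elem_cycle_lang G s" for s t u
  proof -
    obtain p where "u \<noteq> []" and p: "p 0 = s" "p (length u) = s" "inj_on p {..<length u}"
        "\<And>k. k < length u \<Longrightarrow> (p k, u ! k, p (Suc k)) \<in> G"
      using u unfolding elem_cycle_lang_iff by blast
    have "word_path G s u s" using word_path_trace[of u p G] p by simp
    then have "word_path G t u t" using circularD[OF circ] v by metis
    then obtain q where q: "q 0 = t" "q (length u) = t"
        "\<And>k. k < length u \<Longrightarrow> (q k, u ! k, q (Suc k)) \<in> G"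
      by (rule word_path_traceE) blast
    \<comment> \<open>A repetition along the walk from \<open>t\<close> gives a closed infix, which by circularity and
        determinism is also closed along the walk from \<open>s\<close>.\<close>
    have "q i \<noteq> q j" if "i < j" "j < length u" for i j
    proof
      let ?w = "take (j - i) (drop i u)"
      assume "q i = q j"
      then have "word_path G (q i) ?w (q i)" using word_path_subtrace[of u q G i j] q that by simp
      moreover have "q i \<in> verts G" "p i \<in> verts G"
        using edge_verts q(3)[of i] p(4)[of i] that by fastforce+
      ultimately have "word_path G (p i) ?w (p i)" using circularD[OF circ] by metis
      moreover have "word_path G (p i) ?w (p j)" using word_path_subtrace[of u p G i j] p that by simp
      ultimately have "p i = p j" using word_path_deterministic[OF det] by metis
      then show False using inj_onD[OF p(3), of i j] that by simp
    qed
    then have "inj_on q {..<length u}" by (intro linorder_inj_onI') auto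
    with q \<open>u \<noteq> []\<close> show ?thesis unfolding elem_cycle_lang_iff by blast
  qed
  then show ?thesis unfolding elementary_circular_def by blast
qed

lemma elem_cycle_lang_word_path: "u \<in> elem_cycle_lang G s \<Longrightarrow> word_path G s u s"
  unfolding elem_cycle_lang_iff using word_path_trace by metis

text \<open>A shortest non-empty closed infix is an elementary cycle, because an inner repetition
  would give a shorter one.\<close>

lemma closed_word_path_elem_cycle:
  assumes "word_path G s u s" "u \<noteq> []"
  obtains x v y r where "u = x @ v @ y" "word_path G s x r" "v \<in> elem_cycle_lang G r"
    "word_path G r y s"
proof -
  obtain p where p: "p 0 = s" "p (length u) = s"
      "\<And>k. k < length u \<Longrightarrow> (p k, u ! k, p (Suc k)) \<in> G"
    using assms(1) by (rule word_path_traceE) blast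
  \<comment> \<open>\<open>P d\<close> says that some vertex recurs after \<open>d\<close> steps.
    The whole closed walk witnesses \<open>P (length u)\<close>, so a least such \<open>d\<close>
    exists.\<close>
  define P where "P d \<longleftrightarrow> 0 < d \<and> (\<exists>i. i + d \<le> length u \<and> p i = p (i + d))" for d
  have "P (length u)" using assms(2) p by (auto simp: P_def)
  define d where "d = (LEAST d. P d)"
  have "P d" unfolding d_def using \<open>P (length u)\<close> by (rule LeastI)
  then obtain i where i: "0 < d" "i + d \<le> length u" "p i = p (i + d)" by (auto simp: P_def)
  have min: "\<not> P d'" if "d' < d" for d' using that unfolding d_def by (rule not_less_Least)
  let ?v = "take d (drop i u)"
  have "p (i + k) \<noteq> p (i + l)" if "k < l" "l < d" for k l
  proof
    assume "p (i + k) = p (i + l)"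
    then have "P (l - k)" using that i by (auto simp: P_def intro!: exI[of _ "i + k"])
    then show False using min[of "l - k"] that by simp
  qed
  then have "inj_on (\<lambda>k. p (i + k)) {..<d}" by (intro linorder_inj_onI') auto
  then have "?v \<in> elem_cycle_lang G (p i)"
    unfolding elem_cycle_lang_iff using p(3) i
    by (auto intro!: exI[of _ "\<lambda>k. p (i + k)"])
  moreover have "u = take i u @ ?v @ drop (i + d) u"
    by (metis append_take_drop_id drop_drop add.commute)
  moreover have "word_path G s (take i u) (p i)"
    using word_path_subtrace[of u p G 0 i] p i by simp
  moreover have "word_path G (p i) (drop (i + d) u) s"
    using word_path_subtrace[of u p G "i + d" "length u"] p i by simp
  ultimately show ?thesis using that by blast
qed

text \<open>Induction on the length of the closed walk: cut out an elementary cycle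
  \<open>v\<close>, move the shorter closed walk to \<open>t\<close>, and reinsert \<open>v\<close>
  at the vertex \<open>r'\<close> reached there after \<open>x\<close>, where \<open>v\<close> is
  again an elementary cycle.\<close>

lemma elementary_circular_imp_circular:
  assumes "elementary_circular G"
  shows "circular G"
proof -
  have "word_path G t u t" if v: "s \<in> verts G" "t \<in> verts G" and "word_path G s u s" for s t u
    using that(3)
  proof (induction u rule: length_induct)
    case (1 u)
    show ?case
    proof (cases "u = []")
      case False
      then obtain x v y r where u: "u = x @ v @ y" "word_path G s x r" "v \<in> elem_cycle_lang G r"
          "word_path G r y s"
        using closed_word_path_elem_cycle 1(2) by metis
      have "v \<noteq> []" using u(3) by (simp add: elem_cycle_lang_def)
      then have "length (x @ y) < length u" using u(1) by simp
      moreover have "word_path G s (x @ y) s" using u by (auto simp: word_path_append)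
      ultimately have "word_path G t (x @ y) t" using 1(1) by blast
      then obtain r' where r': "word_path G t x r'" "word_path G r' y t"
        by (auto simp: word_path_append)
      have "r \<in> verts G" "r' \<in> verts G" using u r' v word_path_verts by metis+
      then have "v \<in> elem_cycle_lang G r'"
        using assms u(3) unfolding elementary_circular_def by blast
      then show ?thesis using r' u(1) elem_cycle_lang_word_path by (metis word_path_append)
    qed simp
  qed
  then show ?thesis unfolding circular_def path_lang_def by blast
qed

text \<open>The last conjunct shows that fixing the type \<open>'v\<close> for group elements loses
  nothing: a representation over any type \<open>'g\<close> yields one over the vertices.\<close>

theorem theorem4p12:
  fixes G :: "('v, 'a) lgraph"
  assumes "G \<noteq> {}"
  shows "(is_cayley_graph TYPE('v) G \<longleftrightarrow>
            deterministic G \<and> strongly_connected G \<and> simple_graph G \<and> vertex_transitive G)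
       \<and> (deterministic G \<and> strongly_connected G \<and> simple_graph G \<and> vertex_transitive G \<longleftrightarrow>
            deterministic G \<and> strongly_connected G \<and> simple_graph G \<and> circular G)
       \<and> (deterministic G \<and> strongly_connected G \<and> simple_graph G \<and> circular G \<longleftrightarrow>
            deterministic G \<and> strongly_connected G \<and> simple_graph G \<and> elementary_circular G)
       \<and> (is_cayley_graph TYPE('g) G \<longrightarrow> is_cayley_graph TYPE('v) G)"
  using is_cayley_graph_imp_vertex_transitive[where ?'g = 'v and G = G]
    is_cayley_graph_imp_vertex_transitive[where ?'g = 'g and G = G]
    vertex_transitive_imp_is_cayley_graph[OF assms] vertex_transitive_imp_circular[of G]
    circular_imp_vertex_transitive[of G] circular_imp_elementary_circular[of G]
    elementary_circular_imp_circular[of G]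
  by blast

end
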